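(* Let $K$ be a field, let $n\geq 3$, let $R=K[x_1,\ldots,x_n]$ be the polynomial ring in $n$ variables over $K$, and let $\ell_0\geq 2$ be an integer. Then there exist infinitely many monomial ideals in $R$ whose strong persistence index is $\ell_0$.
   Context: For ideals $I,J$ of a commutative ring $R$, $(J:_R I)=\{r\in R \mid rI\subseteq J\}$. Let $I$ be an ideal in a commutative Noetherian ring $R$. A positive integer $\ell_0$ is the strong persistence index of $I$ if $\ell_0$ is the smallest positive integer such that $(I^{\ell+1}:_R I)=I^{\ell}$ for all $\ell\geq \ell_0$. A monomial ideal of $K[x_1,\ldots,x_n]$ is an ideal generated by monomials. *)

theory Defs
  imports
    "HOL-Algebra.Ideal_Product"
    "HOL-Algebra.Algebraic_Closure_Type"
    "HOL-Library.Poly_Mapping"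
    "HOL-Library.Cardinality"
begin

text \<open>
  The polynomial ring over the field \<open>'k\<close> in variables indexed by the finite type \<open>'n\<close> is
  the type \<open>('n \<Rightarrow>\<^sub>0 nat) \<Rightarrow>\<^sub>0 'k\<close> of finitely supported maps from exponent vectors to coefficients,
  with convolution as multiplication.  The function \<open>ring_of_type_algebra\<close> turns it into a ring in
  the sense of \<open>HOL-Algebra\<close>.
\<close>

abbreviation polynomial_ring :: "(('n \<Rightarrow>\<^sub>0 nat) \<Rightarrow>\<^sub>0 'k::field) ring"
  where "polynomial_ring \<equiv> ring_of_type_algebra"

definition ideal_quotient :: "('a, 'b) ring_scheme \<Rightarrow> 'a set \<Rightarrow> 'a set \<Rightarrow> 'a set"
  where "ideal_quotient R J I = {r \<in> carrier R. \<forall>a\<in>I. r \<otimes>\<^bsub>R\<^esub> a \<in> J}"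

text \<open>
  Powers of an ideal are powers in the multiplicative structure of \<^const>\<open>ideals_set\<close>, where
  multiplication is \<^const>\<open>ideal_prod\<close> and the unit is the whole ring.
\<close>

definition strongly_persistent_from :: "('a, 'b) ring_scheme \<Rightarrow> 'a set \<Rightarrow> nat \<Rightarrow> bool"
  where "strongly_persistent_from R I k \<longleftrightarrow>
    (\<forall>l\<ge>k. ideal_quotient R (I [^]\<^bsub>ideals_set R\<^esub> (l + 1)) I = I [^]\<^bsub>ideals_set R\<^esub> l)"

text \<open>
  A relation rather than a function, since for some ideals (e.g. the zero ideal of a nonzero ring)
  no index exists.  Intended for an ideal \<open>I\<close> of a commutative Noetherian ring \<open>R\<close>.
\<close>

definition strong_persistence_index :: "('a, 'b) ring_scheme \<Rightarrow> 'a set \<Rightarrow> nat \<Rightarrow> bool"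
  where "strong_persistence_index R I k \<longleftrightarrow>
    0 < k \<and> strongly_persistent_from R I k \<and>
    (\<forall>j. 0 < j \<and> strongly_persistent_from R I j \<longrightarrow> k \<le> j)"

definition monomials :: "(('n \<Rightarrow>\<^sub>0 nat) \<Rightarrow>\<^sub>0 'k::field) set"
  where "monomials = {Poly_Mapping.single m 1 | m. True}"

definition monomial_ideal :: "(('n \<Rightarrow>\<^sub>0 nat) \<Rightarrow>\<^sub>0 'k::field) set \<Rightarrow> bool"
  where "monomial_ideal I \<longleftrightarrow> (\<exists>M \<subseteq> monomials. I = Idl\<^bsub>polynomial_ring\<^esub> M)"

lemma monomial_ideal_imp_ideal:
  assumes "monomial_ideal I"
  shows "ideal I polynomial_ring"
proof -
  interpret cring "polynomial_ring :: (('a \<Rightarrow>\<^sub>0 nat) \<Rightarrow>\<^sub>0 'b) ring"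
    by (rule cring_from_type_algebra)
  show ?thesis
    using assms genideal_ideal by (auto simp: monomial_ideal_def ring_of_type_algebra_def)
qed

end

theory Submission
  imports Defs
begin

text \<open>
  Fix two of the variables, \<open>x\<close> and \<open>y\<close>, an integer \<open>s \<ge> 1\<close>, and put \<open>t = \<ell>\<^sub>0 s + 1\<close>.  The ideal
  \<open>I = (x, y)\<^sup>s (x\<^sup>t, y\<^sup>t)\<close> has strong persistence index \<open>\<ell>\<^sub>0\<close>.

  The reason is that \<open>I\<^sup>\<ell> = (x, y)\<^bsup>\<ell>s\<^esup> (x\<^sup>t, y\<^sup>t)\<^sup>\<ell>\<close> is contained in \<open>(x, y)\<^bsup>\<ell>(s+t)\<^esup>\<close>, and that
  among its monomials of degree \<open>\<ell>(s+t)\<close> in \<open>x\<close> and \<open>y\<close> the exponents of \<open>x\<close> are those in the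
  blocks \<open>{kt, \<dots>, kt + \<ell>s}\<close> for \<open>0 \<le> k \<le> \<ell>\<close>.  The blocks leave no gap exactly if \<open>\<ell>s + 1 \<ge> t\<close>, that is,
  if \<open>\<ell> \<ge> \<ell>\<^sub>0\<close>; so for \<open>\<ell> \<ge> 1\<close> we have \<open>I\<^sup>\<ell> = (x, y)\<^bsup>\<ell>(s+t)\<^esup>\<close> if and only if \<open>\<ell> \<ge> \<ell>\<^sub>0\<close>
  (\<open>power_exponents_eq_iff\<close>).  On the other hand, once \<open>I\<^bsup>\<ell>+1\<^esup>\<close> is the full power of \<open>(x, y)\<close>,
  so is the quotient: \<open>(I\<^bsup>\<ell>+1\<^esup> : I) = (x, y)\<^bsup>\<ell>(s+t)\<^esup>\<close>, because \<open>x\<^bsup>s+t\<^esup> \<in> I\<close>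
  (\<open>exponent_quotient_power_exponents\<close>).  Hence \<open>(I\<^bsup>\<ell>+1\<^esup> : I) = I\<^sup>\<ell>\<close> holds for all \<open>\<ell> \<ge> \<ell>\<^sub>0\<close>
  and fails for \<open>\<ell> = \<ell>\<^sub>0 - 1 \<ge> 1\<close>.  Different values of \<open>s\<close> give ideals with different initial
  degrees \<open>s + t\<close>, which makes the family infinite.

  All this is a computation with sets of exponent vectors: a monomial ideal consists of the
  polynomials whose exponents lie in a set that is closed under adding arbitrary vectors, and
  under this correspondence products become sumsets and quotients become the evident quotients of
  sets of vectors.
\<close>

section \<open>Monomial ideals as sets of exponent vectors\<close>

abbreviation keys :: "('e \<Rightarrow>\<^sub>0 'k::zero) \<Rightarrow> 'e set"
  where "keys \<equiv> Poly_Mapping.keys"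

abbreviation lookup :: "('e \<Rightarrow>\<^sub>0 'k::zero) \<Rightarrow> 'e \<Rightarrow> 'k"
  where "lookup \<equiv> Poly_Mapping.lookup"

definition absorbing :: "'e::plus set \<Rightarrow> bool"
  where "absorbing S \<longleftrightarrow> (\<forall>u\<in>S. \<forall>v. u + v \<in> S)"

definition supported_on :: "'e set \<Rightarrow> ('e \<Rightarrow>\<^sub>0 'k::zero) set"
  where "supported_on S = {p. keys p \<subseteq> S}"

lemma polynomial_ring_simps [simp]:
  "carrier polynomial_ring = UNIV"
  "p \<otimes>\<^bsub>polynomial_ring\<^esub> q = p * q"
  "p \<oplus>\<^bsub>polynomial_ring\<^esub> q = p + q"
  "\<zero>\<^bsub>polynomial_ring\<^esub> = 0"
  by (simp_all add: ring_of_type_algebra_def)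

lemma cring_polynomial_ring: "cring (polynomial_ring :: (('n \<Rightarrow>\<^sub>0 nat) \<Rightarrow>\<^sub>0 'k::field) ring)"
  by (rule cring_from_type_algebra)

lemma sum_single_lookup: "p = (\<Sum>u\<in>keys p. Poly_Mapping.single u (lookup p u))"
  by (rule poly_mapping_eqI) (simp add: lookup_sum lookup_single when_def in_keys_iff)

lemma lookup_times_monomial:
  fixes p :: "'e::cancel_comm_monoid_add \<Rightarrow>\<^sub>0 'k::semiring_1"
  shows "lookup (p * Poly_Mapping.single v 1) (u + v) = lookup p u"
proof -
  have "p * Poly_Mapping.single v 1 =
      (\<Sum>w\<in>keys p. Poly_Mapping.single w (lookup p w)) * Poly_Mapping.single v 1"
    by (simp flip: sum_single_lookup)
  also have "\<dots> = (\<Sum>w\<in>keys p. Poly_Mapping.single (w + v) (lookup p w))"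
    by (simp add: sum_distrib_right mult_single)
  finally show ?thesis
    by (simp add: lookup_sum lookup_single when_def in_keys_iff)
qed

lemma ideal_supported_on:
  fixes S :: "('n \<Rightarrow>\<^sub>0 nat) set"
  assumes "absorbing S"
  shows "ideal (supported_on S :: (('n \<Rightarrow>\<^sub>0 nat) \<Rightarrow>\<^sub>0 'k::field) set) polynomial_ring"
proof -
  interpret cring "polynomial_ring :: (('n \<Rightarrow>\<^sub>0 nat) \<Rightarrow>\<^sub>0 'k) ring"
    by (rule cring_polynomial_ring)
  have mult: "p * q \<in> supported_on S" if "p \<in> supported_on S" for p q :: "('n \<Rightarrow>\<^sub>0 nat) \<Rightarrow>\<^sub>0 'k"
    using that assms keys_mult[of p q] unfolding supported_on_def absorbing_def by blast
  have neg: "\<ominus>\<^bsub>polynomial_ring\<^esub> p = - p" for p :: "('n \<Rightarrow>\<^sub>0 nat) \<Rightarrow>\<^sub>0 'k"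
    by (rule sum_zero_eq_neg[symmetric]) simp_all
  show ?thesis
  proof (rule idealI)
    show "subgroup (supported_on S :: (('n \<Rightarrow>\<^sub>0 nat) \<Rightarrow>\<^sub>0 'k) set) (add_monoid polynomial_ring)"
    proof (rule add.subgroupI)
      fix a b :: "('n \<Rightarrow>\<^sub>0 nat) \<Rightarrow>\<^sub>0 'k"
      assume "a \<in> supported_on S" and "b \<in> supported_on S"
      then show "a \<oplus>\<^bsub>polynomial_ring\<^esub> b \<in> supported_on S"
        using keys_add[of a b] by (auto simp: supported_on_def)
    qed (auto simp: supported_on_def neg intro: exI[of _ 0])
  qed (use mult in \<open>auto simp: mult.commute intro: ring_axioms\<close>)
qed

text \<open>
  An ideal absorbs coefficients, so containing a monomial is the same as containing all its
  multiples by scalars; sums of these are all the polynomials with the given exponents.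
\<close>

lemma supported_on_subset_ideal:
  fixes J :: "(('n \<Rightarrow>\<^sub>0 nat) \<Rightarrow>\<^sub>0 'k::field) set"
  assumes "ideal J polynomial_ring" and "\<And>u. u \<in> S \<Longrightarrow> Poly_Mapping.single u 1 \<in> J"
  shows "supported_on S \<subseteq> J"
proof
  interpret J: ideal J polynomial_ring by fact
  fix p :: "('n \<Rightarrow>\<^sub>0 nat) \<Rightarrow>\<^sub>0 'k"
  assume p: "p \<in> supported_on S"
  have sum: "sum f A \<in> J" if "\<And>a. a \<in> A \<Longrightarrow> f a \<in> J"
    for f :: "('n \<Rightarrow>\<^sub>0 nat) \<Rightarrow> ('n \<Rightarrow>\<^sub>0 nat) \<Rightarrow>\<^sub>0 'k" and A
    using that additive_subgroup.zero_closed[OF J.additive_subgroup_axioms]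
      additive_subgroup.a_closed[OF J.additive_subgroup_axioms]
    by (induction A rule: infinite_finite_induct) auto
  have coeff: "Poly_Mapping.single u (lookup p u) \<in> J" if "u \<in> keys p" for u
  proof -
    have "Poly_Mapping.single 0 (lookup p u) * Poly_Mapping.single u 1 \<in> J"
      using J.I_l_closed[of "Poly_Mapping.single u 1" "Poly_Mapping.single 0 (lookup p u)"]
        assms(2) p that
      by (auto simp: supported_on_def)
    then show ?thesis by (simp add: mult_single)
  qed
  have "(\<Sum>u\<in>keys p. Poly_Mapping.single u (lookup p u)) \<in> J"
    by (rule sum) (rule coeff)
  then show "p \<in> J"
    by (simp flip: sum_single_lookup)
qed

lemma monomial_ideal_supported_on:
  fixes S :: "('n \<Rightarrow>\<^sub>0 nat) set"
  assumes "absorbing S"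
  shows "monomial_ideal (supported_on S :: (('n \<Rightarrow>\<^sub>0 nat) \<Rightarrow>\<^sub>0 'k::field) set)"
proof -
  interpret cring "polynomial_ring :: (('n \<Rightarrow>\<^sub>0 nat) \<Rightarrow>\<^sub>0 'k) ring"
    by (rule cring_polynomial_ring)
  let ?M = "(\<lambda>u. Poly_Mapping.single u 1) ` S :: (('n \<Rightarrow>\<^sub>0 nat) \<Rightarrow>\<^sub>0 'k) set"
  have "Idl\<^bsub>polynomial_ring\<^esub> ?M \<subseteq> supported_on S"
    using ideal_supported_on[OF assms] by (rule genideal_minimal) (auto simp: supported_on_def)
  moreover have "supported_on S \<subseteq> Idl\<^bsub>polynomial_ring\<^esub> ?M"
    using genideal_ideal[of ?M] genideal_self[of ?M] by (intro supported_on_subset_ideal) auto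
  ultimately show ?thesis
    unfolding monomial_ideal_def monomials_def by (intro exI[of _ ?M]) auto
qed

lemma supported_on_inject:
  "supported_on S = (supported_on T :: ('e \<Rightarrow>\<^sub>0 'k::zero_neq_one) set) \<longleftrightarrow> S = T"
proof -
  have "u \<in> S \<longleftrightarrow> Poly_Mapping.single u (1::'k) \<in> supported_on S" for u and S :: "'e set"
    by (simp add: supported_on_def)
  then show ?thesis by blast
qed

lemma ideal_prod_supported_on:
  fixes S T :: "('n \<Rightarrow>\<^sub>0 nat) set"
  assumes "absorbing S" and "absorbing T"
  shows "ideal_prod polynomial_ring (supported_on S) (supported_on T) =
    (supported_on {u + v |u v. u \<in> S \<and> v \<in> T} :: (('n \<Rightarrow>\<^sub>0 nat) \<Rightarrow>\<^sub>0 'k::field) set)"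
    (is "?P = ?Q")
proof
  interpret cring "polynomial_ring :: (('n \<Rightarrow>\<^sub>0 nat) \<Rightarrow>\<^sub>0 'k) ring"
    by (rule cring_polynomial_ring)
  show "?P \<subseteq> ?Q"
  proof
    fix p assume "p \<in> ?P"
    then show "p \<in> ?Q"
    proof induction
      case (prod p q)
      then show ?case
        using keys_mult[of p q] by (fastforce simp: supported_on_def)
    next
      case (sum p q)
      then show ?case
        using keys_add[of p q] by (auto simp: supported_on_def)
    qed
  qed
  show "?Q \<subseteq> ?P"
  proof (rule supported_on_subset_ideal)
    show "ideal ?P polynomial_ring"
      using assms by (intro ideal_prod_is_ideal ideal_supported_on)
    fix w assume "w \<in> {u + v |u v. u \<in> S \<and> v \<in> T}"
    then obtain u v where "w = u + v" "u \<in> S" "v \<in> T" by blast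
    moreover from this have "Poly_Mapping.single u (1::'k) \<otimes>\<^bsub>polynomial_ring\<^esub> Poly_Mapping.single v 1 \<in> ?P"
      by (intro ideal_prod.prod) (simp_all add: supported_on_def)
    ultimately show "Poly_Mapping.single w (1::'k) \<in> ?P"
      by (simp add: mult_single)
  qed
qed

definition exponent_quotient :: "'e::plus set \<Rightarrow> 'e set \<Rightarrow> 'e set"
  where "exponent_quotient S T = {u. \<forall>v\<in>T. u + v \<in> S}"

text \<open>
  Multiplication by a monomial translates the exponents of a polynomial without any cancellation;
  therefore multiplying by the monomials with exponents in \<open>T\<close> already tests each exponent of the
  polynomial separately.
\<close>

lemma ideal_quotient_supported_on:
  fixes S T :: "('n \<Rightarrow>\<^sub>0 nat) set"
  shows "ideal_quotient polynomial_ring (supported_on S) (supported_on T) =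
    (supported_on (exponent_quotient S T) :: (('n \<Rightarrow>\<^sub>0 nat) \<Rightarrow>\<^sub>0 'k::field) set)"
proof (intro equalityI subsetI)
  fix p :: "('n \<Rightarrow>\<^sub>0 nat) \<Rightarrow>\<^sub>0 'k"
  assume p: "p \<in> ideal_quotient polynomial_ring (supported_on S) (supported_on T)"
  have "u + v \<in> S" if "u \<in> keys p" "v \<in> T" for u v
  proof -
    have "p * Poly_Mapping.single v 1 \<in> supported_on S"
      using p that by (auto simp: ideal_quotient_def supported_on_def)
    moreover have "u + v \<in> keys (p * Poly_Mapping.single v 1)"
      using that by (simp add: in_keys_iff lookup_times_monomial)
    ultimately show ?thesis by (auto simp: supported_on_def)
  qed
  then show "p \<in> supported_on (exponent_quotient S T)"
    by (auto simp: supported_on_def exponent_quotient_def)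
next
  fix p :: "('n \<Rightarrow>\<^sub>0 nat) \<Rightarrow>\<^sub>0 'k"
  assume "p \<in> supported_on (exponent_quotient S T)"
  then have "keys (p * q) \<subseteq> S" if "keys q \<subseteq> T" for q
    using that keys_mult[of p q] by (fastforce simp: supported_on_def exponent_quotient_def)
  then show "p \<in> ideal_quotient polynomial_ring (supported_on S) (supported_on T)"
    by (auto simp: ideal_quotient_def supported_on_def)
qed

section \<open>The exponents of the powers of the ideal\<close>

text \<open>
  The exponents of the monomials in \<open>(x, y)\<^bsup>\<ell>s\<^esup> (x\<^sup>t, y\<^sup>t)\<^sup>\<ell>\<close>: such a monomial is divisible by some
  \<open>x\<^bsup>kt\<^esup> y\<^bsup>(\<ell>-k)t\<^esup>\<close> with a cofactor of degree at least \<open>\<ell>s\<close> in \<open>x\<close> and \<open>y\<close>.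
\<close>

definition power_exponents :: "'n \<Rightarrow> 'n \<Rightarrow> nat \<Rightarrow> nat \<Rightarrow> nat \<Rightarrow> ('n \<Rightarrow>\<^sub>0 nat) set"
  where "power_exponents x y s t l = {u. \<exists>k\<le>l. k * t \<le> lookup u x \<and> (l - k) * t \<le> lookup u y \<and>
    l * (s + t) \<le> lookup u x + lookup u y}"

lemma absorbing_power_exponents: "absorbing (power_exponents x y s t l)"
  unfolding absorbing_def power_exponents_def
proof (intro ballI allI CollectI)
  fix u v :: "'a \<Rightarrow>\<^sub>0 nat"
  assume "u \<in> {u. \<exists>k\<le>l. k * t \<le> lookup u x \<and> (l - k) * t \<le> lookup u y \<and>
    l * (s + t) \<le> lookup u x + lookup u y}"
  then obtain k where "k \<le> l" "k * t \<le> lookup u x" "(l - k) * t \<le> lookup u y"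
    "l * (s + t) \<le> lookup u x + lookup u y"
    by blast
  then show "\<exists>k\<le>l. k * t \<le> lookup (u + v) x \<and> (l - k) * t \<le> lookup (u + v) y \<and>
    l * (s + t) \<le> lookup (u + v) x + lookup (u + v) y"
    unfolding lookup_add by (intro exI[of _ k]) linarith
qed

lemma degree_power_exponents:
  "u \<in> power_exponents x y s t l \<Longrightarrow> l * (s + t) \<le> lookup u x + lookup u y"
  by (auto simp: power_exponents_def)

lemma power_exponents_0: "power_exponents x y s t 0 = UNIV"
  by (auto simp: power_exponents_def)

lemma single_in_power_exponents:
  "x \<noteq> y \<Longrightarrow> Poly_Mapping.single x (s + t) \<in> power_exponents x y s t 1"
  unfolding power_exponents_def
  by (intro CollectI exI[of _ 1]) (simp add: lookup_single when_def)

lemma power_exponents_commute: "power_exponents x y s t l = power_exponents y x s t l"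
proof -
  have "power_exponents x y s t l \<subseteq> power_exponents y x s t l" for x y :: 'a
  proof
    fix u assume "u \<in> power_exponents x y s t l"
    then obtain k where "k \<le> l" "k * t \<le> lookup u x" "(l - k) * t \<le> lookup u y"
      "l * (s + t) \<le> lookup u x + lookup u y"
      by (auto simp: power_exponents_def)
    then show "u \<in> power_exponents y x s t l"
      unfolding power_exponents_def by (intro CollectI exI[of _ "l - k"]) auto
  qed
  then show ?thesis by blast
qed

text \<open>
  A monomial of \<open>(x, y)\<^bsup>(\<ell>+1)s\<^esup> (x\<^sup>t, y\<^sup>t)\<^bsup>\<ell>+1\<^esup>\<close> that uses the factor \<open>x\<^sup>t\<close> splits off this factor
  together with \<open>s\<close> of its at least \<open>(\<ell>+1)s\<close> further factors \<open>x\<close> and \<open>y\<close>.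
\<close>

lemma split_off_power_exponents:
  assumes "x \<noteq> y" "k \<le> l" "Suc k * t \<le> lookup w x" "(l - k) * t \<le> lookup w y"
    "Suc l * (s + t) \<le> lookup w x + lookup w y"
  shows "\<exists>u v. w = u + v \<and> u \<in> power_exponents x y s t l \<and> v \<in> power_exponents x y s t 1"
proof -
  \<comment> \<open>Of the \<open>s\<close> further factors, as many as possible are factors \<open>x\<close>; the rest are factors \<open>y\<close>,
    and a factor \<open>y\<close> is only used if the remaining power of \<open>x\<close> is exactly \<open>x\<^bsup>kt\<^esup>\<close>.\<close>
  define a where "a = min s (lookup w x - Suc k * t)"
  define v where "v = Poly_Mapping.single x (t + a) + Poly_Mapping.single y (s - a)"
  have vx: "lookup v x = t + a" and vy: "lookup v y = s - a"
    and v_other: "\<And>z. z \<noteq> x \<Longrightarrow> z \<noteq> y \<Longrightarrow> lookup v z = 0"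
    using assms(1) by (auto simp: v_def lookup_add lookup_single when_def)
  have a: "a \<le> s" "Suc k * t + a \<le> lookup w x"
    using assms(3) by (auto simp: a_def)
  have "l * t = k * t + (l - k) * t"
    using assms(2) by (simp flip: add_mult_distrib)
  then have split: "Suc l * (s + t) = s + l * s + Suc k * t + (l - k) * t"
    by (simp add: distrib_left)
  have b: "(l - k) * t + (s - a) \<le> lookup w y"
    using assms(3-5) split unfolding a_def min_def by (auto split: if_splits)
  have "lookup v z \<le> lookup w z" for z
    using a b vx vy v_other[of z] by (cases "z = x \<or> z = y") auto
  then have w: "w = (w - v) + v"
    by (intro poly_mapping_eqI) (simp add: lookup_add lookup_minus)
  have "w - v \<in> power_exponents x y s t l"
    using assms(2,5) a b vx vy unfolding power_exponents_def
    by (intro CollectI exI[of _ k]) (auto simp: lookup_minus)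
  moreover have "v \<in> power_exponents x y s t 1"
    using a vx vy unfolding power_exponents_def by (intro CollectI exI[of _ 1]) auto
  ultimately show ?thesis using w by blast
qed

lemma sumset_power_exponents:
  assumes "x \<noteq> y"
  shows "{u + v |u v. u \<in> power_exponents x y s t l \<and> v \<in> power_exponents x y s t 1} =
    power_exponents x y s t (Suc l)"
proof (intro equalityI subsetI)
  fix w assume "w \<in> {u + v |u v. u \<in> power_exponents x y s t l \<and> v \<in> power_exponents x y s t 1}"
  then obtain u v k j where w: "w = u + v"
    and u: "k \<le> l" "k * t \<le> lookup u x" "(l - k) * t \<le> lookup u y"
      "l * (s + t) \<le> lookup u x + lookup u y"
    and v: "j \<le> 1" "j * t \<le> lookup v x" "(1 - j) * t \<le> lookup v y"
      "s + t \<le> lookup v x + lookup v y"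
    by (auto simp: power_exponents_def)
  have "(Suc l - (k + j)) * t = (l - k) * t + (1 - j) * t"
    using u(1) v(1) by (simp flip: add_mult_distrib)
  then show "w \<in> power_exponents x y s t (Suc l)"
    using u v unfolding power_exponents_def w
    by (intro CollectI exI[of _ "k + j"]) (auto simp: lookup_add add_mult_distrib)
next
  fix w assume w: "w \<in> power_exponents x y s t (Suc l)"
  then obtain k where k: "k \<le> Suc l" "k * t \<le> lookup w x" "(Suc l - k) * t \<le> lookup w y"
    "Suc l * (s + t) \<le> lookup w x + lookup w y"
    unfolding power_exponents_def by blast
  show "w \<in> {u + v |u v. u \<in> power_exponents x y s t l \<and> v \<in> power_exponents x y s t 1}"
  proof (cases k)
    case 0
    \<comment> \<open>All the factors are \<open>y\<^sup>t\<close> here, and one of them is split off instead.\<close>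
    then have "\<exists>u v. w = u + v \<and> u \<in> power_exponents y x s t l \<and> v \<in> power_exponents y x s t 1"
      using assms k by (intro split_off_power_exponents[of y x l l]) auto
    then show ?thesis by (simp add: power_exponents_commute[of y x])
  next
    case (Suc j)
    then show ?thesis
      using split_off_power_exponents[of x y j l t w s] assms k by auto
  qed
qed

text \<open>
  The blocks \<open>{kt, \<dots>, kt + \<ell>s}\<close> of exponents of \<open>x\<close> cover everything if and only if each ends
  right before the next one or later; otherwise \<open>\<ell>s + 1\<close> is the first gap.
\<close>

lemma power_exponents_eq_iff:
  assumes "x \<noteq> y" and "0 < l"
  shows "power_exponents x y s t l = {u. l * (s + t) \<le> lookup u x + lookup u y} \<longleftrightarrow> t \<le> l * s + 1"
    (is "_ = ?F \<longleftrightarrow> _")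
proof
  assume t: "t \<le> l * s + 1"
  have "u \<in> power_exponents x y s t l" if u: "l * (s + t) \<le> lookup u x + lookup u y" for u
  proof (cases "l * t \<le> lookup u x")
    case True
    then show ?thesis
      using u unfolding power_exponents_def by (intro CollectI exI[of _ l]) auto
  next
    case False
    define k where "k = lookup u x div t"
    have "t > 0" using False by (cases t) auto
    have "k < l"
      using False \<open>t > 0\<close> by (simp add: k_def div_less_iff_less_mult)
    have "k * t \<le> lookup u x" "lookup u x < k * t + t"
      using \<open>t > 0\<close> dividend_less_div_times[of t "lookup u x"] by (auto simp: k_def)
    moreover have "l * t = k * t + (l - k) * t"
      using \<open>k < l\<close> by (simp flip: add_mult_distrib)
    ultimately have "(l - k) * t \<le> lookup u y"
      using t u unfolding distrib_left by linarith
    then show ?thesis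
      using u \<open>k < l\<close> \<open>k * t \<le> lookup u x\<close> unfolding power_exponents_def
      by (intro CollectI exI[of _ k]) auto
  qed
  then show "power_exponents x y s t l = ?F"
    by (auto dest: degree_power_exponents)
next
  assume eq: "power_exponents x y s t l = ?F"
  show "t \<le> l * s + 1"
  proof (rule ccontr)
    assume "\<not> t \<le> l * s + 1"
    then have t: "l * s + 1 < t" by simp
    define u where "u = Poly_Mapping.single x (l * s + 1) + Poly_Mapping.single y (l * t - 1)"
    have "lookup u x = l * s + 1" and "lookup u y = l * t - 1"
      using assms(1) by (auto simp: u_def lookup_add lookup_single when_def)
    moreover have "l * t > 0" using t assms(2) by simp
    ultimately have "u \<in> ?F" by (simp add: algebra_simps)
    then have "u \<in> power_exponents x y s t l"
      by (simp only: eq)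
    then obtain k where k: "k * t \<le> l * s + 1" "(l - k) * t \<le> l * t - 1"
      using \<open>lookup u x = _\<close> \<open>lookup u y = _\<close> by (auto simp: power_exponents_def)
    \<comment> \<open>The first bound leaves only \<open>k = 0\<close>, which contradicts the second.\<close>
    have "k = 0"
      using k(1) t by (cases k) auto
    then show False
      using k(2) \<open>l * t > 0\<close> by (metis diff_less diff_zero leD zero_less_one)
  qed
qed

lemma exponent_quotient_power_exponents:
  assumes "x \<noteq> y" and "t \<le> Suc l * s + 1"
  shows "exponent_quotient (power_exponents x y s t (Suc l)) (power_exponents x y s t 1) =
    {u. l * (s + t) \<le> lookup u x + lookup u y}"
proof -
  have full: "power_exponents x y s t (Suc l) = {u. Suc l * (s + t) \<le> lookup u x + lookup u y}"
    by (rule iffD2[OF power_exponents_eq_iff[OF assms(1)] assms(2)]) simp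
  show ?thesis
  proof (intro equalityI subsetI)
    fix u assume "u \<in> exponent_quotient (power_exponents x y s t (Suc l)) (power_exponents x y s t 1)"
    then have "u + Poly_Mapping.single x (s + t) \<in> power_exponents x y s t (Suc l)"
      using single_in_power_exponents[OF assms(1)] by (auto simp: exponent_quotient_def)
    then show "u \<in> {u. l * (s + t) \<le> lookup u x + lookup u y}"
      using assms(1) by (simp add: full lookup_add lookup_single when_def)
  next
    fix u assume "u \<in> {u. l * (s + t) \<le> lookup u x + lookup u y}"
    then show "u \<in> exponent_quotient (power_exponents x y s t (Suc l)) (power_exponents x y s t 1)"
      using degree_power_exponents[of _ x y s t 1]
      by (fastforce simp: exponent_quotient_def full lookup_add)
  qed
qed

section \<open>The strong persistence index\<close>

text \<open>The ideal \<open>(x, y)\<^sup>s (x\<^sup>t, y\<^sup>t)\<close>.\<close>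

definition block_ideal :: "'n \<Rightarrow> 'n \<Rightarrow> nat \<Rightarrow> nat \<Rightarrow> (('n \<Rightarrow>\<^sub>0 nat) \<Rightarrow>\<^sub>0 'k::field) set"
  where "block_ideal x y s t = supported_on (power_exponents x y s t 1)"

lemma block_ideal_power:
  assumes "x \<noteq> y"
  shows "(block_ideal x y s t :: (('n \<Rightarrow>\<^sub>0 nat) \<Rightarrow>\<^sub>0 'k::field) set) [^]\<^bsub>ideals_set polynomial_ring\<^esub> l =
    supported_on (power_exponents x y s t l)"
proof (induction l)
  case 0
  then show ?case
    by (simp add: nat_pow_def ideals_set_def power_exponents_0 supported_on_def)
next
  case (Suc l)
  have "(block_ideal x y s t :: (('n \<Rightarrow>\<^sub>0 nat) \<Rightarrow>\<^sub>0 'k) set) [^]\<^bsub>ideals_set polynomial_ring\<^esub> Suc l =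
    ideal_prod polynomial_ring
      (supported_on (power_exponents x y s t l)) (block_ideal x y s t)"
    using Suc by (simp add: nat_pow_def ideals_set_def)
  also have "\<dots> = supported_on (power_exponents x y s t (Suc l))"
    unfolding block_ideal_def
    by (subst ideal_prod_supported_on)
      (simp_all only: absorbing_power_exponents sumset_power_exponents[OF assms])
  finally show ?case .
qed

lemma block_ideal_quotient_eq_iff:
  assumes "x \<noteq> y" and "0 < l" and "t \<le> Suc l * s + 1"
  shows "ideal_quotient polynomial_ring
      ((block_ideal x y s t :: (('n \<Rightarrow>\<^sub>0 nat) \<Rightarrow>\<^sub>0 'k::field) set) [^]\<^bsub>ideals_set polynomial_ring\<^esub> (l + 1))
      (block_ideal x y s t) =
    block_ideal x y s t [^]\<^bsub>ideals_set polynomial_ring\<^esub> l \<longleftrightarrow> t \<le> l * s + 1"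
proof -
  have "ideal_quotient polynomial_ring (supported_on (power_exponents x y s t (l + 1)))
      (supported_on (power_exponents x y s t 1)) =
    (supported_on {u. l * (s + t) \<le> lookup u x + lookup u y} :: (('n \<Rightarrow>\<^sub>0 nat) \<Rightarrow>\<^sub>0 'k) set)"
    using exponent_quotient_power_exponents[OF assms(1,3)]
    by (simp only: ideal_quotient_supported_on Suc_eq_plus1)
  then show ?thesis
    unfolding block_ideal_power[OF assms(1)] unfolding block_ideal_def
    by (simp only: supported_on_inject eq_commute[of "Collect _"] power_exponents_eq_iff[OF assms(1,2)])
qed

lemma strong_persistence_index_block_ideal:
  assumes "x \<noteq> y" and "2 \<le> l0" and "0 < s"
  shows "strong_persistence_index polynomial_ring
    (block_ideal x y s (l0 * s + 1) :: (('n \<Rightarrow>\<^sub>0 nat) \<Rightarrow>\<^sub>0 'k::field) set) l0"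
  unfolding strong_persistence_index_def strongly_persistent_from_def
proof (intro conjI allI impI)
  fix l assume "l0 \<le> l"
  then have "0 < l" and "l0 * s + 1 \<le> l * s + 1" and "l0 * s + 1 \<le> Suc l * s + 1"
    using assms(2) by (auto simp only: add_le_cancel_right intro!: mult_le_mono1)
  then show "ideal_quotient polynomial_ring
      ((block_ideal x y s (l0 * s + 1) :: (('n \<Rightarrow>\<^sub>0 nat) \<Rightarrow>\<^sub>0 'k) set)
        [^]\<^bsub>ideals_set polynomial_ring\<^esub> (l + 1)) (block_ideal x y s (l0 * s + 1)) =
    block_ideal x y s (l0 * s + 1) [^]\<^bsub>ideals_set polynomial_ring\<^esub> l"
    by (intro iffD2[OF block_ideal_quotient_eq_iff[OF assms(1)]])
next
  fix j :: nat
  assume j: "0 < j \<and> (\<forall>l\<ge>j. ideal_quotient polynomial_ring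
      ((block_ideal x y s (l0 * s + 1) :: (('n \<Rightarrow>\<^sub>0 nat) \<Rightarrow>\<^sub>0 'k) set)
        [^]\<^bsub>ideals_set polynomial_ring\<^esub> (l + 1)) (block_ideal x y s (l0 * s + 1)) =
    block_ideal x y s (l0 * s + 1) [^]\<^bsub>ideals_set polynomial_ring\<^esub> l)"
  show "l0 \<le> j"
  proof (rule ccontr)
    assume "\<not> l0 \<le> j"
    then obtain l where l: "l0 = Suc l" "j \<le> l" "0 < l"
      using j assms(2) by (cases l0) auto
    then have "l0 * s + 1 \<le> l * s + 1"
      using j assms(1) by (subst block_ideal_quotient_eq_iff[symmetric]) auto
    then show False using l assms(3) by simp
  qed
qed (use assms in simp)

lemma initial_degree_block_ideal:
  assumes "x \<noteq> y"
    and "block_ideal x y s t = (block_ideal x y s' t' :: (('n \<Rightarrow>\<^sub>0 nat) \<Rightarrow>\<^sub>0 'k::field) set)"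
  shows "s + t = s' + t'"
proof -
  have eq: "power_exponents x y s t 1 = power_exponents x y s' t' 1"
    using assms(2) by (simp only: block_ideal_def supported_on_inject)
  have le: "s' + t' \<le> s + t"
    if "power_exponents x y s t 1 = power_exponents x y s' t' 1" for s t s' t'
    using degree_power_exponents[of "Poly_Mapping.single x (s + t)" x y s' t' 1]
      single_in_power_exponents[OF assms(1), of s t] assms(1) that
    by (simp add: lookup_single when_def)
  show ?thesis
    using le[OF eq] le[OF eq[symmetric]] by simp
qed

theorem theorem2p11:
  fixes l0 :: nat
  assumes "CARD('n::finite) \<ge> 3"
    and "l0 \<ge> 2"
  shows "infinite {I :: (('n \<Rightarrow>\<^sub>0 nat) \<Rightarrow>\<^sub>0 'k::field) set.
           monomial_ideal I \<and> strong_persistence_index polynomial_ring I l0}"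
proof -
  have "\<not> CARD('n) \<le> 1" using assms(1) by simp
  then obtain x y :: 'n where "x \<noteq> y"
    by (auto simp: card_le_Suc0_iff_eq)
  define I where "I s = (block_ideal x y s (l0 * s + 1) :: (('n \<Rightarrow>\<^sub>0 nat) \<Rightarrow>\<^sub>0 'k) set)" for s
  have "inj I"
  proof (rule injI)
    fix s s' assume "I s = I s'"
    then have "s + (l0 * s + 1) = s' + (l0 * s' + 1)"
      unfolding I_def by (rule initial_degree_block_ideal[OF \<open>x \<noteq> y\<close>])
    then have "Suc l0 * s = Suc l0 * s'" by simp
    then show "s = s'" by (simp only: mult_cancel1) simp
  qed
  then have "infinite (I ` {0<..})"
    by (metis finite_imageD infinite_Ioi inj_on_subset subset_UNIV)
  moreover have "monomial_ideal (I s)" for s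
    unfolding I_def block_ideal_def
    by (intro monomial_ideal_supported_on absorbing_power_exponents)
  moreover have "strong_persistence_index polynomial_ring (I s) l0" if "0 < s" for s
    unfolding I_def by (rule strong_persistence_index_block_ideal[OF \<open>x \<noteq> y\<close> assms(2) that])
  ultimately have "infinite (I ` {0<..})" and
    "I ` {0<..} \<subseteq> {I. monomial_ideal I \<and> strong_persistence_index polynomial_ring I l0}"
    by auto
  then show ?thesis
    using finite_subset by blast
qed

end
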